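(* Let $N\ge 2$ be an integer, and let $1<m<N$, $p\ge 0$, $q\ge 0$ be real numbers with $$q(N-m)+p(N-1)<N(m-1).$$ Let $u$ be a positive (weak) solution of the inequality $$-\Delta_m u\ge u^q|\nabla u|^p\quad\text{in }\mathbb{R}^N.$$ Then $u$ is a constant.
   Context: $\Delta_m u=\operatorname{div}(|\nabla u|^{m-2}\nabla u)$ is the $m$-Laplacian. A positive weak solution of $-\Delta_m u\ge g(x,u,\nabla u)$ in an open set $\Omega$ is a function $u\in C^1(\Omega)$, $u>0$, with $\int_\Omega|\nabla u|^{m-2}\nabla u\cdot\nabla\varphi\,dx\ge\int_\Omega g(x,u,\nabla u)\varphi\,dx$ for all nonnegative $\varphi\in C_c^\infty(\Omega)$. The convention $|\nabla u|^0=1$ is used when $p=0$ (and $u^0=1$ when $q=0$). *)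

theory Defs
  imports "HOL-Analysis.Analysis"
begin

definition grad :: "('a::euclidean_space \<Rightarrow> real) \<Rightarrow> 'a \<Rightarrow> 'a" where
  "grad f x = (SOME D. GDERIV f x :> D)"

lemma GDERIV_grad:
  fixes f :: "'a::euclidean_space \<Rightarrow> real"
  assumes "f differentiable (at x)"
  shows "GDERIV f x :> grad f x"
proof -
  obtain f' where f': "(f has_derivative f') (at x)"
    using assms by (auto simp: differentiable_def)
  interpret linear f' using f' by (rule has_derivative_linear)
  have "f' = (\<lambda>h. h \<bullet> adjoint f' 1)"
    using adjoint_works[OF linear_axioms, of _ 1] by (simp add: fun_eq_iff)
  then have "GDERIV f x :> adjoint f' 1"
    using f' unfolding gderiv_def by metis
  then show ?thesis
    unfolding grad_def by (rule someI)
qed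

text \<open>The class $C^k(\Omega)$ of real-valued functions on an open set; for \<open>b \<in> Basis\<close>,
  \<open>grad f x \<bullet> b\<close> is the partial derivative of \<open>f\<close> at \<open>x\<close> in direction \<open>b\<close>.\<close>

primrec Ck_on :: "nat \<Rightarrow> 'a::euclidean_space set \<Rightarrow> ('a \<Rightarrow> real) \<Rightarrow> bool" where
  "Ck_on 0 \<Omega> f \<longleftrightarrow> continuous_on \<Omega> f"
| "Ck_on (Suc k) \<Omega> f \<longleftrightarrow>
     (\<forall>x\<in>\<Omega>. f differentiable (at x)) \<and> (\<forall>b\<in>Basis. Ck_on k \<Omega> (\<lambda>x. grad f x \<bullet> b))"

text \<open>The space $C_c^\infty(\Omega)$; its elements are extended by zero to the whole space.\<close>

definition test_function :: "'a::euclidean_space set \<Rightarrow> ('a \<Rightarrow> real) \<Rightarrow> bool" where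
  "test_function \<Omega> \<phi> \<longleftrightarrow>
     (\<forall>k. Ck_on k UNIV \<phi>) \<and>
     compact (closure {x. \<phi> x \<noteq> 0}) \<and> closure {x. \<phi> x \<noteq> 0} \<subseteq> \<Omega>"

text \<open>Real powers of nonnegative reals with the convention \<open>0\<^sup>0 = 1\<close>; note that
  \<open>0 powr 0 = 0\<close>.\<close>

definition rpow :: "real \<Rightarrow> real \<Rightarrow> real" where
  "rpow x a = (if a = 0 then 1 else x powr a)"

text \<open>Positive weak solutions of $-\Delta_m u \ge g(x,u,\nabla u)$ in \<open>\<Omega>\<close>. Where \<open>grad u x = 0\<close>,
  the vector $|\nabla u|^{m-2}\nabla u$ is zero whatever value the scalar factor has, so for
  \<open>m > 1\<close> it is continuous. The left integrand is then continuous with compact support in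
  \<open>\<Omega>\<close>, and so is the right one whenever \<open>g(x,u,\<nabla>u)\<close> is continuous, so that both
  integrals exist.\<close>

definition positive_weak_solution ::
  "real \<Rightarrow> ('a::euclidean_space \<Rightarrow> real \<Rightarrow> 'a \<Rightarrow> real) \<Rightarrow> 'a set \<Rightarrow> ('a \<Rightarrow> real) \<Rightarrow> bool" where
  "positive_weak_solution m g \<Omega> u \<longleftrightarrow>
     open \<Omega> \<and> Ck_on 1 \<Omega> u \<and> (\<forall>x\<in>\<Omega>. u x > 0) \<and>
     (\<forall>\<phi>. test_function \<Omega> \<phi> \<and> (\<forall>x. \<phi> x \<ge> 0) \<longrightarrow>
        (LINT x:\<Omega>|lebesgue. (rpow (norm (grad u x)) (m - 2) *\<^sub>R grad u x) \<bullet> grad \<phi> x)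
          \<ge> (LINT x:\<Omega>|lebesgue. g x (u x) (grad u x) * \<phi> x))"

end

theory Submission
  imports Defs "HOL-Real_Asymp.Real_Asymp"
begin

text \<open>The proof tests the inequality with \<open>u\<^bsup>-d\<^esup>\<zeta>\<^sup>k\<close>, where \<open>\<zeta>\<close> is a cutoff at scale
  \<open>R\<close> with \<open>|\<nabla>\<zeta>| \<le> 2/R\<close> and \<open>d > 0\<close>. This gives
  \[ \int u^{q-d}|\nabla u|^p\zeta^k + d\int u^{-d-1}|\nabla u|^m\zeta^k
     \le k\int u^{-d}|\nabla u|^{m-1}\zeta^{k-1}|\nabla\zeta| . \]
  Let \<open>T\<^sub>1\<close> and \<open>T\<^sub>2\<close> be the two functions multiplying \<open>\<zeta>\<^sup>k\<close> on the left. If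
  \<open>u\<^bsup>-d\<^esup>|\<nabla>u|\<^bsup>m-1\<^esup> = T\<^sub>1\<^bsup>a\<^esup> T\<^sub>2\<^bsup>b\<^esup>\<close> with positive weights \<open>a + b + c = 1\<close>, Young's
  inequality absorbs the right-hand side into the left up to a multiple of
  \<open>\<integral> |\<nabla>\<zeta>|\<^bsup>1/c\<^esup>\<close>, which is of order \<open>R\<^bsup>N-1/c\<^esup>\<close>. This tends to \<open>0\<close> as soon as
  \<open>c < 1/N\<close>, and then \<open>\<nabla>u = 0\<close>.

  The exponents are chosen by starting from \<open>c\<close>: the balance of powers of \<open>u\<close> and
  \<open>|\<nabla>u|\<close> determines \<open>a\<close>, \<open>b\<close> and \<open>d\<close>, and for \<open>c = 1/N\<close> the requirement \<open>d > 0\<close>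
  is exactly \<open>q (N - m) + p (N - 1) < N (m - 1)\<close> (lemma \<open>exponents_exist\<close>). No upper bound is put
  on \<open>d\<close>; when \<open>p + q < m - 1\<close> it exceeds \<open>m - 1\<close>, and thanks to this freedom the sublinear
  and superlinear ranges need no separate treatment.

  The pointwise absorption is \<open>absorb_gradient_term\<close>, its integrated form
  \<open>energy_estimate\<close>. As \<open>u\<close> is only of class \<open>C\<^sup>1\<close>, so is \<open>u\<^bsup>-d\<^esup>\<zeta>\<^sup>k\<close>; the admissibility
  of such functions, \<open>weak_inequality_C1\<close>, is proved by mollification.\<close>

section \<open>Gradients and the classes \<open>C\<^sup>k\<close>\<close>

lemma grad_eqI:
  fixes f :: "'a::euclidean_space \<Rightarrow> real"
  assumes "GDERIV f x :> D"
  shows "grad f x = D"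
proof -
  have "f differentiable (at x)"
    using assms unfolding gderiv_def differentiable_def by blast
  from GDERIV_grad[OF this] assms have "(\<lambda>h. h \<bullet> grad f x) = (\<lambda>h. h \<bullet> D)"
    unfolding gderiv_def by (rule has_derivative_unique)
  then show ?thesis
    by (metis vector_eq_ldot)
qed

lemma GDERIV_imp_differentiable:
  "GDERIV f x :> D \<Longrightarrow> f differentiable (at x)"
  unfolding gderiv_def differentiable_def by blast

lemma Ck_on_1I:
  fixes f :: "'a::euclidean_space \<Rightarrow> real"
  assumes "\<And>x. GDERIV f x :> G x" and "continuous_on UNIV G"
  shows "Ck_on 1 UNIV f"
proof -
  have "grad f = G"
    using grad_eqI[OF assms(1)] by blast
  then show ?thesis
    using assms GDERIV_imp_differentiable[OF assms(1)] by (auto intro!: continuous_intros)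
qed

lemma Ck_on_1D:
  fixes f :: "'a::euclidean_space \<Rightarrow> real"
  assumes "Ck_on 1 UNIV f"
  shows "GDERIV f x :> grad f x" and "continuous_on UNIV (grad f)" and "continuous_on UNIV f"
proof -
  have d: "f differentiable (at x)" for x
    using assms by simp
  then show "GDERIV f x :> grad f x"
    by (rule GDERIV_grad)
  show "continuous_on UNIV (grad f)"
    using assms continuous_on_componentwise[of UNIV "grad f"] by simp
  show "continuous_on UNIV f"
    using d differentiable_imp_continuous_on
    by (metis differentiable_at_imp_differentiable_on)
qed

lemma Ck_on_Suc_imp: "Ck_on (Suc k) \<Omega> f \<Longrightarrow> Ck_on k \<Omega> f"
proof (induction k arbitrary: f)
  case 0
  then show ?case
    by (auto intro!: continuous_at_imp_continuous_on differentiable_imp_continuous_within)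
next
  case (Suc k)
  then show ?case by (metis Ck_on.simps(2))
qed

lemma Ck_on_SucI:
  fixes f :: "'a::euclidean_space \<Rightarrow> real"
  assumes "\<And>x. GDERIV f x :> G x" and "\<And>b. b \<in> Basis \<Longrightarrow> Ck_on k UNIV (\<lambda>x. G x \<bullet> b)"
  shows "Ck_on (Suc k) UNIV f"
proof -
  have "grad f = G"
    using grad_eqI[OF assms(1)] by blast
  then show ?thesis
    using assms GDERIV_imp_differentiable[OF assms(1)] by auto
qed

lemma Ck_on_SucD:
  fixes f :: "'a::euclidean_space \<Rightarrow> real"
  assumes "Ck_on (Suc k) UNIV f"
  shows "GDERIV f x :> grad f x" and "b \<in> Basis \<Longrightarrow> Ck_on k UNIV (\<lambda>x. grad f x \<bullet> b)"
  using assms GDERIV_grad[of f x] by simp_all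

lemma Ck_on_const: "Ck_on k UNIV (\<lambda>x::'a::euclidean_space. c)"
  by (induction k arbitrary: c) (auto intro!: Ck_on_SucI[OF GDERIV_const] simp del: Ck_on.simps(2))

lemma Ck_on_add:
  "Ck_on k UNIV f \<Longrightarrow> Ck_on k UNIV g \<Longrightarrow> Ck_on k UNIV (\<lambda>x::'a::euclidean_space. f x + g x)"
proof (induction k arbitrary: f g)
  case 0
  then show ?case by (auto intro: continuous_intros)
next
  case (Suc k)
  show ?case
    by (rule Ck_on_SucI[OF GDERIV_add[OF Ck_on_SucD(1)[OF Suc.prems(1)] Ck_on_SucD(1)[OF Suc.prems(2)]]])
      (simp add: inner_add_left Suc.IH Ck_on_SucD(2)[OF Suc.prems(1)] Ck_on_SucD(2)[OF Suc.prems(2)])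
qed

lemma Ck_on_mult:
  "Ck_on k UNIV f \<Longrightarrow> Ck_on k UNIV g \<Longrightarrow> Ck_on k UNIV (\<lambda>x::'a::euclidean_space. f x * g x)"
proof (induction k arbitrary: f g)
  case 0
  then show ?case by (auto intro: continuous_intros)
next
  case (Suc k)
  show ?case
    by (rule Ck_on_SucI[OF GDERIV_mult[OF Ck_on_SucD(1)[OF Suc.prems(1)] Ck_on_SucD(1)[OF Suc.prems(2)]]])
      (simp add: inner_add_left Ck_on_add Suc.IH Ck_on_SucD(2)[OF Suc.prems(1)]
         Ck_on_SucD(2)[OF Suc.prems(2)] Ck_on_Suc_imp[OF Suc.prems(1)] Ck_on_Suc_imp[OF Suc.prems(2)])
qed

lemma Ck_on_inner: "Ck_on k UNIV (\<lambda>x::'a::euclidean_space. x \<bullet> v)"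
proof (cases k)
  case (Suc j)
  have "GDERIV (\<lambda>x. x \<bullet> v) x :> v" for x
    unfolding gderiv_def by (auto intro!: derivative_eq_intros)
  then show ?thesis
    unfolding Suc by (rule Ck_on_SucI) (rule Ck_on_const)
qed (auto intro!: continuous_intros)

section \<open>Smooth bumps\<close>

text \<open>The smooth function \<open>exp (- 1 / t)\<close>, flat at \<open>0\<close>, is \<open>flat_exp 0\<close>. The family is closed
  under differentiation up to linear combinations, so an induction over all members at once yields
  smoothness of every order.\<close>

definition flat_exp :: "nat \<Rightarrow> real \<Rightarrow> real" where
  "flat_exp n t = (if t > 0 then exp (- 1 / t) / t ^ n else 0)"

lemma flat_exp_has_derivative:
  "(flat_exp n has_real_derivative (flat_exp (n + 2) t - n * flat_exp (n + 1) t)) (at t)"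
proof -
  consider "t > 0" | "t < 0" | "t = 0" by linarith
  then show ?thesis
  proof cases
    case 1
    have "((\<lambda>t. t ^ n) has_real_derivative n * t ^ n / t) (at t)"
      using DERIV_pow[of n t] 1 by (cases n) simp_all
    moreover have "((\<lambda>t. exp (- 1 / t)) has_real_derivative exp (- 1 / t) / t\<^sup>2) (at t)"
      using 1 by (auto intro!: derivative_eq_intros simp: field_simps power2_eq_square)
    ultimately have "((\<lambda>t. exp (- 1 / t) / t ^ n) has_real_derivative
        (exp (- 1 / t) / t\<^sup>2 * t ^ n - exp (- 1 / t) * (n * t ^ n / t)) / (t ^ n * t ^ n)) (at t)"
      using 1 by (intro DERIV_divide) auto
    also have "(exp (- 1 / t) / t\<^sup>2 * t ^ n - exp (- 1 / t) * (n * t ^ n / t)) / (t ^ n * t ^ n)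
        = flat_exp (n + 2) t - n * flat_exp (n + 1) t"
      using 1 by (simp add: flat_exp_def field_simps power2_eq_square)
    finally have "((\<lambda>t. exp (- 1 / t) / t ^ n) has_real_derivative
        (flat_exp (n + 2) t - n * flat_exp (n + 1) t)) (at t)" .
    then show ?thesis
      by (rule has_field_derivative_transform_within_open[of _ _ _ "{0<..}"])
         (use 1 in \<open>auto simp: flat_exp_def\<close>)
  next
    case 2
    have "((\<lambda>t. 0) has_real_derivative (flat_exp (n + 2) t - n * flat_exp (n + 1) t)) (at t)"
      using 2 by (auto simp: flat_exp_def)
    then show ?thesis
      by (rule has_field_derivative_transform_within_open[of _ _ _ "{..<0}"])
         (use 2 in \<open>auto simp: flat_exp_def\<close>)
  next
    case 3
    have "((\<lambda>s::real. exp (- 1 / s) / s ^ n / s) \<longlongrightarrow> 0) (at_right 0)"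
      by real_asymp
    then have r: "((\<lambda>s::real. flat_exp n s / s) \<longlongrightarrow> 0) (at_right 0)"
      by (rule Lim_transform_eventually) (auto simp: eventually_at_filter flat_exp_def)
    have l: "((\<lambda>s::real. flat_exp n s / s) \<longlongrightarrow> 0) (at_left 0)"
      by (rule Lim_transform_eventually[OF tendsto_const]) (auto simp: eventually_at_filter flat_exp_def)
    have "((\<lambda>s::real. flat_exp n s / s) \<longlongrightarrow> 0) (at 0)"
      using l r by (rule filterlim_split_at)
    then show ?thesis
      using 3 by (simp add: has_field_derivative_iff flat_exp_def)
  qed
qed

lemma continuous_flat_exp: "continuous_on UNIV (flat_exp n)"
  by (meson DERIV_continuous_on flat_exp_has_derivative has_field_derivative_at_within)

lemma GDERIV_flat_exp_ball:
  fixes x :: "'a::euclidean_space"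
  shows "GDERIV (\<lambda>x. flat_exp n (s - x \<bullet> x)) x :>
    (flat_exp (n + 2) (s - x \<bullet> x) + (- n) * flat_exp (n + 1) (s - x \<bullet> x)) *\<^sub>R ((- 2) *\<^sub>R x)"
proof -
  have "GDERIV (\<lambda>x. s - x \<bullet> x) x :> (- 2) *\<^sub>R x"
    unfolding gderiv_def by (auto intro!: derivative_eq_intros simp: inner_commute)
  from GDERIV_DERIV_compose[OF this flat_exp_has_derivative] show ?thesis
    by simp
qed

lemma Ck_on_flat_exp_ball:
  "Ck_on k UNIV (\<lambda>x::'a::euclidean_space. flat_exp n (s - x \<bullet> x))"
proof (induction k arbitrary: n)
  case 0
  have "continuous_on UNIV (\<lambda>x::'a. s - x \<bullet> x)"
    by (intro continuous_intros)
  then show ?case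
    using continuous_on_compose2[OF continuous_flat_exp] by simp
next
  case (Suc k)
  show ?case
  proof (rule Ck_on_SucI[OF GDERIV_flat_exp_ball])
    fix b :: 'a
    have "Ck_on k UNIV (\<lambda>x. (flat_exp (n + 2) (s - x \<bullet> x) + (- real n) * flat_exp (n + 1) (s - x \<bullet> x)) *
        ((- 2) * (x \<bullet> b)))"
      by (intro Ck_on_mult Ck_on_add Ck_on_const Ck_on_inner Suc.IH)
    then show "Ck_on k UNIV (\<lambda>x. ((flat_exp (n + 2) (s - x \<bullet> x) + (- real n) * flat_exp (n + 1) (s - x \<bullet> x)) *\<^sub>R
        ((- 2) *\<^sub>R x)) \<bullet> b)"
      by (simp add: algebra_simps)
  qed
qed

section \<open>Convolution\<close>

definition conv :: "('a::euclidean_space \<Rightarrow> real) \<Rightarrow> ('a \<Rightarrow> real) \<Rightarrow> 'a \<Rightarrow> real" where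
  "conv f g x = (\<integral>y. f y * g (x - y) \<partial>lborel)"

lemma lborel_integral_reflect_shift:
  fixes F :: "'a::euclidean_space \<Rightarrow> real"
  assumes "F \<in> borel_measurable borel"
  shows "(\<integral>y. F (x - y) \<partial>lborel) = (\<integral>y. F y \<partial>lborel)"
proof -
  have T: "(\<lambda>y. x + (\<Sum>j\<in>Basis. ((- 1) * (y \<bullet> j)) *\<^sub>R j)) = (\<lambda>y. x - y)"
    by (auto simp: sum_negf euclidean_representation)
  have "lborel = distr lborel borel (\<lambda>y. x - y)"
    using lborel_affine_euclidean[where c = "\<lambda>_::'a. - 1" and t = x] unfolding T by (simp add: density_1)
  then have "(\<integral>y. F y \<partial>lborel) = (\<integral>y. F y \<partial>distr lborel borel (\<lambda>y. x - y))"
    by simp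
  also have "\<dots> = (\<integral>y. F (x - y) \<partial>lborel)"
    by (rule integral_distr) (use assms in auto)
  finally show ?thesis by simp
qed

lemma conv_commute:
  assumes "continuous_on UNIV f" and "continuous_on UNIV g"
  shows "conv f g = conv g f"
proof
  fix x
  have [measurable]: "f \<in> borel_measurable borel" "g \<in> borel_measurable borel"
    using assms by (auto intro: borel_measurable_continuous_onI)
  have "(\<integral>y. f (x - y) * g (x - (x - y)) \<partial>lborel) = (\<integral>y. f y * g (x - y) \<partial>lborel)"
    by (rule lborel_integral_reflect_shift[where F = "\<lambda>y. f y * g (x - y)"]) measurable
  then show "conv f g x = conv g f x"
    by (simp add: conv_def mult.commute)
qed

lemma integrable_continuous_compact_support:
  fixes f :: "'a::euclidean_space \<Rightarrow> 'b::euclidean_space"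
  assumes "continuous_on UNIV f" and "\<And>x. x \<notin> K \<Longrightarrow> f x = 0" and "compact K"
  shows "integrable lborel f"
proof -
  have "integrable lborel (\<lambda>x. indicator K x *\<^sub>R f x)"
    by (rule borel_integrable_compact[OF assms(3) continuous_on_subset[OF assms(1)]]) simp
  moreover have "(\<lambda>x. indicator K x *\<^sub>R f x) = f"
    using assms(2) by (auto simp: indicator_def)
  ultimately show ?thesis by simp
qed

lemma conv_eq_integral:
  fixes f g :: "'a::euclidean_space \<Rightarrow> real"
  assumes "continuous_on UNIV f" and "continuous_on UNIV g"
    and "\<forall>y. y \<notin> cbox a b \<longrightarrow> f y = 0"
  shows "conv f g = (\<lambda>x. integral (cbox a b) (\<lambda>y. f y * g (x - y)))"
proof
  fix x
  have c: "continuous_on UNIV (\<lambda>y. f y * g (x - y))"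
    by (intro continuous_intros assms(1) continuous_on_compose2[OF assms(2)]) auto
  have "set_integrable lborel (cbox a b) (\<lambda>y. f y * g (x - y))"
    unfolding set_integrable_def
    by (rule borel_integrable_compact[OF compact_cbox continuous_on_subset[OF c]]) simp
  from set_borel_integral_eq_integral(2)[OF this]
  have "integral (cbox a b) (\<lambda>y. f y * g (x - y)) =
      (\<integral>y. indicator (cbox a b) y *\<^sub>R (f y * g (x - y)) \<partial>lborel)"
    by (simp add: set_lebesgue_integral_def)
  also have "(\<lambda>y. indicator (cbox a b) y *\<^sub>R (f y * g (x - y))) = (\<lambda>y. f y * g (x - y))"
    using assms(3) by (auto simp: indicator_def fun_eq_iff)
  finally show "conv f g x = integral (cbox a b) (\<lambda>y. f y * g (x - y))"
    by (simp add: conv_def)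
qed

lemma continuous_conv:
  fixes f g :: "'a::euclidean_space \<Rightarrow> real"
  assumes "continuous_on UNIV f" and "continuous_on UNIV g"
    and "\<forall>y. y \<notin> cbox a b \<longrightarrow> f y = 0"
  shows "continuous_on UNIV (conv f g)"
proof -
  have "continuous_on (UNIV \<times> cbox a b) (\<lambda>(x, y). f y * g (x - y))"
    unfolding split_beta
    by (intro continuous_intros continuous_on_compose2[OF assms(1)] continuous_on_compose2[OF assms(2)]) auto
  from integral_continuous_on_param[OF this] show ?thesis
    unfolding conv_eq_integral[OF assms] .
qed

text \<open>The compact support of \<open>f\<close> turns the convolution into an integral over a fixed box, where
  differentiation under the integral sign is available. Applied to \<open>conv f g\<close> and, after
  commuting, to \<open>conv g f\<close>, it lets the derivatives fall on either factor.\<close>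

lemma conv_differentiable:
  fixes f g :: "'a::euclidean_space \<Rightarrow> real"
  assumes f: "continuous_on UNIV f" "\<forall>y. y \<notin> cbox a b \<longrightarrow> f y = 0"
    and g: "Ck_on 1 UNIV g"
  shows "conv f g differentiable (at x)"
    and "grad (conv f g) x \<bullet> v = conv f (\<lambda>z. grad g z \<bullet> v) x"
proof -
  note g' = Ck_on_1D[OF g]
  define fx where "fx x y = f y *\<^sub>R blinfun_inner_right (grad g (x - y))" for x y
  have cfx: "continuous_on (UNIV \<times> cbox a b) (\<lambda>(x, y). fx x y)"
    unfolding split_beta fx_def
    by (intro continuous_intros continuous_on_compose2[OF f(1)] continuous_on_compose2[OF g'(2)]
        bounded_linear.continuous_on[OF bounded_linear_blinfun_inner_right]) auto
  have der: "((\<lambda>x. f y * g (x - y)) has_derivative blinfun_apply (fx x y)) (at x)" for x y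
  proof -
    have "((\<lambda>x. g (x - y)) has_derivative (\<lambda>h. h \<bullet> grad g (x - y))) (at x)"
      by (rule has_derivative_compose[of "\<lambda>x. x - y" "\<lambda>h. h" x UNIV g "\<lambda>h. h \<bullet> grad g (x - y)"])
        (use g'(1)[of "x - y"] in \<open>auto simp: gderiv_def intro!: derivative_eq_intros\<close>)
    from has_derivative_mult_right[OF this, of "f y"] show ?thesis
      by (simp add: fx_def scaleR_blinfun.rep_eq inner_commute)
  qed
  have int: "(\<lambda>y. f y * g (x - y)) integrable_on cbox a b" for x
    by (intro integrable_continuous continuous_intros continuous_on_compose2[OF f(1)]
        continuous_on_compose2[OF g'(3)]) auto
  have intfx: "(\<lambda>y. fx x y) integrable_on cbox a b"
    unfolding fx_def
    by (intro integrable_continuous continuous_intros continuous_on_compose2[OF f(1)]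
        continuous_on_compose2[OF g'(2)]
        bounded_linear.continuous_on[OF bounded_linear_blinfun_inner_right]) auto
  have D: "(conv f g has_derivative integral (cbox a b) (fx x)) (at x)"
    unfolding conv_eq_integral[OF f(1) g'(3) f(2)]
    by (rule leibniz_rule[where U = UNIV]) (auto intro: der int cfx)
  then show d: "conv f g differentiable (at x)"
    unfolding differentiable_def by blast
  from GDERIV_grad[OF d] D have "(\<lambda>h. h \<bullet> grad (conv f g) x) = blinfun_apply (integral (cbox a b) (fx x))"
    unfolding gderiv_def by (rule has_derivative_unique)
  then have "v \<bullet> grad (conv f g) x = blinfun_apply (integral (cbox a b) (fx x)) v"
    by metis
  also have "\<dots> = integral (cbox a b) (\<lambda>y. f y * (grad g (x - y) \<bullet> v))"
    by (simp add: blinfun_apply_integral[OF intfx] fx_def scaleR_blinfun.rep_eq)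
  also have "\<dots> = conv f (\<lambda>z. grad g z \<bullet> v) x"
    by (subst conv_eq_integral[OF f(1) _ f(2)]) (auto intro!: continuous_intros g'(2))
  finally show "grad (conv f g) x \<bullet> v = conv f (\<lambda>z. grad g z \<bullet> v) x"
    by (simp add: inner_commute)
qed

lemma Ck_on_conv:
  fixes f g :: "'a::euclidean_space \<Rightarrow> real"
  assumes f: "continuous_on UNIV f" "\<forall>y. y \<notin> cbox a b \<longrightarrow> f y = 0"
  shows "Ck_on k UNIV g \<Longrightarrow> Ck_on k UNIV (conv f g)"
proof (induction k arbitrary: g)
  case 0
  then show ?case
    using continuous_conv[OF f(1) _ f(2)] by auto
next
  case (Suc k)
  have g: "Ck_on 1 UNIV g"
    using Suc.prems by (induction k) (auto intro: Ck_on_Suc_imp simp del: Ck_on.simps)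
  show ?case
    using conv_differentiable[OF f g] Suc.IH[OF Ck_on_SucD(2)[OF Suc.prems]] by simp
qed

section \<open>Mollification\<close>

lemma integral_pos_of_continuous:
  fixes f :: "'a::euclidean_space \<Rightarrow> real"
  assumes "continuous_on UNIV f" and "\<And>x. f x \<ge> 0" and "integrable lborel f" and "f x0 > 0"
  shows "(\<integral>x. f x \<partial>lborel) > 0"
proof -
  have "isCont f x0"
    using assms(1) by (simp add: continuous_on_eq_continuous_at)
  then obtain r where r: "r > 0" "\<And>x. dist x x0 < r \<Longrightarrow> dist (f x) (f x0) < f x0 / 2"
    unfolding continuous_at_eps_delta using assms(4) by (metis half_gt_zero)
  have "0 < f x0 / 2 * measure lborel (ball x0 r)"
    using assms(4) r(1) content_ball_pos[of r x0] by simp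
  also have "\<dots> = (\<integral>x. f x0 / 2 * indicator (ball x0 r) x \<partial>lborel)"
    by simp
  also have "\<dots> \<le> (\<integral>x. f x \<partial>lborel)"
  proof (rule integral_mono)
    show "integrable lborel (\<lambda>x. f x0 / 2 * indicator (ball x0 r) x)"
      by (intro integrable_mult_right integrable_real_indicator emeasure_bounded_finite) simp_all
    show "f x0 / 2 * indicator (ball x0 r) x \<le> f x" for x
    proof (cases "dist x x0 < r")
      case True
      then have "\<bar>f x - f x0\<bar> < f x0 / 2"
        using r(2) by (simp add: dist_real_def)
      then have "f x0 / 2 \<le> f x" by linarith
      then show ?thesis using True by (simp add: indicator_def dist_commute)
    qed (use assms(2) in \<open>simp add: indicator_def dist_commute\<close>)
  qed (fact assms(3))
  finally show ?thesis .
qed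

definition mollifier :: "real \<Rightarrow> 'a::euclidean_space \<Rightarrow> real" where
  "mollifier r x = flat_exp 0 (r\<^sup>2 - x \<bullet> x) / (\<integral>y. flat_exp 0 (r\<^sup>2 - (y::'a) \<bullet> y) \<partial>lborel)"

lemma flat_exp_nonneg: "flat_exp n t \<ge> 0"
  by (simp add: flat_exp_def)

lemma flat_exp_ball_eq_0:
  assumes "r \<ge> 0" and "norm x \<ge> r"
  shows "flat_exp n (r\<^sup>2 - x \<bullet> x) = 0"
proof -
  have "r\<^sup>2 \<le> x \<bullet> x"
    using assms by (metis power_mono power2_norm_eq_inner)
  then show ?thesis by (simp add: flat_exp_def)
qed

lemma mollifier_eq_0: "r \<ge> 0 \<Longrightarrow> norm x \<ge> r \<Longrightarrow> mollifier r x = 0"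
  by (simp add: mollifier_def flat_exp_ball_eq_0)

lemma mollifier_nonneg: "mollifier r x \<ge> 0"
  unfolding mollifier_def by (intro divide_nonneg_nonneg Bochner_Integration.integral_nonneg flat_exp_nonneg)

lemma Ck_on_mollifier: "Ck_on k UNIV (mollifier r :: 'a::euclidean_space \<Rightarrow> real)"
  using Ck_on_mult[OF Ck_on_flat_exp_ball[of k 0 "r\<^sup>2"]
      Ck_on_const[of k "inverse (\<integral>y. flat_exp 0 (r\<^sup>2 - (y::'a) \<bullet> y) \<partial>lborel)"]]
  unfolding mollifier_def[abs_def] divide_inverse .

lemma continuous_mollifier: "continuous_on UNIV (mollifier r)"
  using Ck_on_mollifier[of 0 r] by simp

lemma integrable_mollifier: "r \<ge> 0 \<Longrightarrow> integrable lborel (mollifier r)"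
  by (rule integrable_continuous_compact_support[OF continuous_mollifier, of "cball 0 r"])
    (auto intro: mollifier_eq_0)

lemma integral_mollifier:
  assumes "r > 0"
  shows "(\<integral>y. mollifier r (y::'a::euclidean_space) \<partial>lborel) = 1"
proof -
  have c: "continuous_on UNIV (\<lambda>x::'a. flat_exp 0 (r\<^sup>2 - x \<bullet> x))"
    using Ck_on_flat_exp_ball[of 0] by simp
  have "integrable lborel (\<lambda>x::'a. flat_exp 0 (r\<^sup>2 - x \<bullet> x))"
    by (rule integrable_continuous_compact_support[OF c, of "cball 0 r"])
      (use assms in \<open>auto intro: flat_exp_ball_eq_0\<close>)
  then have "(\<integral>x. flat_exp 0 (r\<^sup>2 - (x::'a) \<bullet> x) \<partial>lborel) > 0"
    by (rule integral_pos_of_continuous[OF c flat_exp_nonneg, of 0]) (use assms in \<open>simp add: flat_exp_def\<close>)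
  then show ?thesis
    unfolding mollifier_def by simp
qed

lemma mollifier_vanishes:
  assumes "r \<ge> 0"
  obtains a b where "\<forall>y. y \<notin> cbox a b \<longrightarrow> mollifier r (y::'a::euclidean_space) = 0"
proof -
  obtain a where "cball (0::'a) r \<subseteq> cbox (- a) a"
    using bounded_subset_cbox_symmetric[OF bounded_cball] by blast
  then have "\<forall>y. y \<notin> cbox (- a) a \<longrightarrow> mollifier r (y::'a) = 0"
    using mollifier_eq_0[OF assms] by force
  then show thesis by (rule that)
qed

text \<open>The quantitative form covers three uses: convergence (small \<open>e\<close>), a uniform bound
  (\<open>e = 2 sup |f|\<close>), and the support of the convolution (\<open>e = 0\<close>).\<close>

lemma conv_mollifier_close:
  fixes f :: "'a::euclidean_space \<Rightarrow> real"
  assumes f: "continuous_on UNIV f" and r: "r > 0"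
    and close: "\<And>y. norm y < r \<Longrightarrow> \<bar>f (x - y) - f x\<bar> \<le> e"
  shows "\<bar>conv (mollifier r) f x - f x\<bar> \<le> e"
proof -
  have c: "continuous_on UNIV (\<lambda>y. mollifier r y * f (x - y))"
    by (intro continuous_intros continuous_mollifier continuous_on_compose2[OF f]) auto
  have i: "integrable lborel (\<lambda>y. mollifier r y * f (x - y))"
    by (rule integrable_continuous_compact_support[OF c, of "cball 0 r"])
      (use r in \<open>auto intro: mollifier_eq_0\<close>)
  have j: "integrable lborel (\<lambda>y::'a. mollifier r y * s)" for s
    using integrable_mollifier[of r, where ?'a = 'a] r by simp
  have "conv (mollifier r) f x - f x
      = (\<integral>y. mollifier r y * f (x - y) \<partial>lborel) - (\<integral>y. mollifier r (y::'a) * f x \<partial>lborel)"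
    using integral_mollifier[OF r, where ?'a = 'a] by (simp add: conv_def)
  also have "\<dots> = (\<integral>y. mollifier r y * f (x - y) - mollifier r y * f x \<partial>lborel)"
    by (rule Bochner_Integration.integral_diff[symmetric, OF i j])
  finally have "\<bar>conv (mollifier r) f x - f x\<bar>
      \<le> (\<integral>y. \<bar>mollifier r y * f (x - y) - mollifier r y * f x\<bar> \<partial>lborel)"
    using integral_abs_bound by simp
  also have "\<dots> \<le> (\<integral>y. mollifier r (y::'a) * e \<partial>lborel)"
  proof (rule integral_mono)
    show "integrable lborel (\<lambda>y. \<bar>mollifier r y * f (x - y) - mollifier r y * f x\<bar>)"
      by (intro integrable_abs Bochner_Integration.integrable_diff i j)
    fix y :: 'a
    show "\<bar>mollifier r y * f (x - y) - mollifier r y * f x\<bar> \<le> mollifier r y * e"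
    proof (cases "norm y < r")
      case True
      then show ?thesis
        using close[OF True] mollifier_nonneg[of r y]
        by (simp add: right_diff_distrib[symmetric] abs_mult mult_left_mono)
    qed (use r in \<open>simp add: mollifier_eq_0\<close>)
  qed (rule j)
  also have "\<dots> = e"
    using integral_mollifier[OF r, where ?'a = 'a] by simp
  finally show ?thesis .
qed

lemma conv_mollifier_eq_0:
  fixes f :: "'a::euclidean_space \<Rightarrow> real"
  assumes "continuous_on UNIV f" and "r > 0" and f0: "\<And>x. norm x > R \<Longrightarrow> f x = 0"
    and x: "norm x > R + r"
  shows "conv (mollifier r) f x = 0"
proof -
  have "\<bar>conv (mollifier r) f x - f x\<bar> \<le> 0"
  proof (rule conv_mollifier_close[OF assms(1,2)])
    fix y :: 'a assume "norm y < r"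
    then have "norm (x - y) > R" "norm x > R"
      using x norm_triangle_ineq2[of x y] assms(2) by linarith+
    then show "\<bar>f (x - y) - f x\<bar> \<le> 0"
      by (simp add: f0)
  qed
  then show ?thesis
    using f0[of x] x assms(2) by simp
qed

text \<open>Boundedness on balls about the origin suffices, as every compact set lies in one.\<close>

definition locally_bounded :: "('a::euclidean_space \<Rightarrow> 'b::real_normed_vector) \<Rightarrow> bool" where
  "locally_bounded w \<longleftrightarrow> (\<forall>R. \<exists>M. \<forall>x\<in>cball 0 R. norm (w x) \<le> M)"

lemma integrable_locally_bounded_mult:
  fixes w f :: "'a::euclidean_space \<Rightarrow> real"
  assumes w: "w \<in> borel_measurable borel" "locally_bounded w"
    and f: "continuous_on UNIV f" "\<And>x. norm x > R \<Longrightarrow> f x = 0"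
  shows "integrable lborel (\<lambda>x. w x * f x)"
proof -
  have [measurable]: "f \<in> borel_measurable borel" "w \<in> borel_measurable borel"
    using f(1) w(1) by (auto intro: borel_measurable_continuous_onI)
  obtain M where M: "\<And>x. x \<in> cball 0 R \<Longrightarrow> \<bar>w x\<bar> \<le> M"
    using w(2) unfolding locally_bounded_def by (metis real_norm_def)
  have "integrable lborel f"
    by (rule integrable_continuous_compact_support[OF f(1), of "cball 0 R"]) (auto intro: f(2))
  then have "integrable lborel (\<lambda>x. M * f x)"
    by simp
  then show ?thesis
  proof (rule Bochner_Integration.integrable_bound)
    have "norm (w x * f x) \<le> norm (M * f x)" for x
      using M[of x] f(2)[of x] by (cases "norm x > R") (auto simp: abs_mult intro!: mult_right_mono)
    then show "AE x in lborel. norm (w x * f x) \<le> norm (M * f x)"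
      by simp
  qed measurable
qed

lemma tendsto_integral_mult_conv_mollifier:
  fixes w f :: "'a::euclidean_space \<Rightarrow> real"
  assumes w: "w \<in> borel_measurable borel" "locally_bounded w"
    and f: "continuous_on UNIV f" "\<And>x. norm x > R \<Longrightarrow> f x = 0"
  shows "(\<lambda>j. \<integral>x. w x * conv (mollifier (1 / Suc j)) f x \<partial>lborel)
           \<longlonglongrightarrow> (\<integral>x. w x * f x \<partial>lborel)"
proof -
  have conv_cont: "continuous_on UNIV (conv (mollifier (1 / Suc j)) f)" for j
  proof -
    obtain a b where "\<forall>y. y \<notin> cbox a b \<longrightarrow> mollifier (1 / Suc j) (y::'a) = 0"
      using mollifier_vanishes[of "1 / Suc j"] by auto
    then show ?thesis
      by (rule continuous_conv[OF continuous_mollifier f(1)])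
  qed
  have [measurable]: "f \<in> borel_measurable borel" "w \<in> borel_measurable borel"
    "\<And>j. conv (mollifier (1 / Suc j)) f \<in> borel_measurable borel"
    using f(1) w(1) conv_cont by (auto intro: borel_measurable_continuous_onI)
  obtain M where M: "\<And>x. x \<in> cball 0 (R + 1) \<Longrightarrow> \<bar>w x\<bar> \<le> M"
    using w(2) unfolding locally_bounded_def by (metis real_norm_def)
  have "compact (f ` cball 0 R)"
    by (rule compact_continuous_image[OF continuous_on_subset[OF f(1)]]) auto
  then obtain B0 where "\<forall>x\<in>cball 0 R. \<bar>f x\<bar> \<le> B0"
    by (auto dest!: compact_imp_bounded simp: bounded_iff)
  then have B: "\<bar>f x\<bar> \<le> max B0 0" for x
    by (cases "norm x > R") (auto simp: f(2) intro: max.coboundedI1)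
  define B where "B = max B0 0"
  note B = B[folded B_def]
  show ?thesis
  proof (rule integral_dominated_convergence[where w = "\<lambda>x. indicator (cball 0 (R + 1)) x * (\<bar>M\<bar> * (3 * B))"])
    show "integrable lborel (\<lambda>x::'a. indicator (cball 0 (R + 1)) x * (\<bar>M\<bar> * (3 * B)))"
      by (intro integrable_mult_left integrable_real_indicator emeasure_bounded_finite) simp_all
    have "norm (w x * conv (mollifier (1 / Suc j)) f x)
            \<le> indicator (cball 0 (R + 1)) x * (\<bar>M\<bar> * (3 * B))" for j x
    proof (cases "norm x > R + 1")
      case True
      then have "norm x > R + 1 / Suc j"
        using order.strict_trans1[of "R + 1 / Suc j" "R + 1" "norm x"] by simp
      then have "conv (mollifier (1 / Suc j)) f x = 0"
        by (intro conv_mollifier_eq_0[OF f(1) _ f(2)]) auto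
      then show ?thesis using True by (simp add: indicator_def)
    next
      case False
      have "\<bar>conv (mollifier (1 / Suc j)) f x - f x\<bar> \<le> 2 * B"
      proof (rule conv_mollifier_close[OF f(1)])
        show "\<bar>f (x - y) - f x\<bar> \<le> 2 * B" for y
          using B[of x] B[of "x - y"] by linarith
      qed simp
      then have "\<bar>conv (mollifier (1 / Suc j)) f x\<bar> \<le> 3 * B"
        using B[of x] by linarith
      moreover have "\<bar>w x\<bar> \<le> \<bar>M\<bar>"
        using M[of x] False by force
      ultimately show ?thesis
        using False by (auto simp: abs_mult indicator_def intro!: mult_mono)
    qed
    then show "AE x in lborel. norm (w x * conv (mollifier (1 / Suc j)) f x)
        \<le> indicator (cball 0 (R + 1)) x * (\<bar>M\<bar> * (3 * B))" for j
      by simp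
    have "(\<lambda>j. conv (mollifier (1 / Suc j)) f x) \<longlonglongrightarrow> f x" for x
    proof (rule LIMSEQ_I)
      fix e :: real assume "e > 0"
      moreover have "isCont f x"
        using f(1) by (simp add: continuous_on_eq_continuous_at)
      ultimately obtain \<delta> where \<delta>: "\<delta> > 0" "\<And>x'. dist x' x < \<delta> \<Longrightarrow> dist (f x') (f x) < e / 2"
        unfolding continuous_at_eps_delta by (metis half_gt_zero)
      obtain n where n: "1 / Suc n < \<delta>"
        using \<delta>(1) by (metis nat_approx_posE)
      have "norm (conv (mollifier (1 / Suc j)) f x - f x) < e" if "j \<ge> n" for j
      proof -
        have "1 / real (Suc j) \<le> 1 / real (Suc n)"
          using that by (intro divide_left_mono) auto
        with n have j: "1 / real (Suc j) < \<delta>" by linarith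
        have "\<bar>conv (mollifier (1 / Suc j)) f x - f x\<bar> \<le> e / 2"
        proof (rule conv_mollifier_close[OF f(1)])
          fix y :: 'a assume "norm y < 1 / real (Suc j)"
          then show "\<bar>f (x - y) - f x\<bar> \<le> e / 2"
            using j \<delta>(2)[of "x - y"] by (simp add: dist_norm)
        qed simp
        then show ?thesis using \<open>e > 0\<close> by simp
      qed
      then show "\<exists>n. \<forall>j\<ge>n. norm (conv (mollifier (1 / Suc j)) f x - f x) < e"
        by blast
    qed
    then show "AE x in lborel. (\<lambda>j. w x * conv (mollifier (1 / Suc j)) f x) \<longlonglongrightarrow> w x * f x"
      by (intro AE_I2 tendsto_mult tendsto_const)
  qed measurable
qed

lemma grad_eq_0_outside:
  fixes f :: "'a::euclidean_space \<Rightarrow> real"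
  assumes "\<And>x. norm x > R \<Longrightarrow> f x = 0" and "norm x > R"
  shows "grad f x = 0"
proof (rule grad_eqI)
  have "((\<lambda>x. 0) has_derivative (\<lambda>h. h \<bullet> 0)) (at x)"
    by simp
  then show "GDERIV f x :> 0"
    unfolding gderiv_def
    by (rule has_derivative_transform_within_open[of _ _ x UNIV "- cball 0 R"])
      (use assms in auto)
qed

lemma locally_bounded_inner:
  assumes "locally_bounded A"
  shows "locally_bounded (\<lambda>x. A x \<bullet> v)"
  unfolding locally_bounded_def
proof
  fix R
  obtain M where M: "\<forall>x\<in>cball 0 R. norm (A x) \<le> M"
    using assms unfolding locally_bounded_def by blast
  then have "norm (A x \<bullet> v) \<le> M * norm v" if "x \<in> cball 0 R" for x
    using Cauchy_Schwarz_ineq2[of "A x" v] that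
    by (metis mult_right_mono norm_ge_zero order_trans real_norm_def)
  then show "\<exists>M. \<forall>x\<in>cball 0 R. norm (A x \<bullet> v) \<le> M"
    by blast
qed

text \<open>The function \<open>u\<^bsup>-d\<^esup>\<zeta>\<^sup>k\<close> used below is in general only of class \<open>C\<^sup>1\<close>, so it is not
  a test function. Its mollifications are: they are smooth because the derivatives can be put on the
  mollifier, nonnegative, and supported in a common ball, while their gradients are the mollified
  gradients and converge boundedly.\<close>

theorem weak_inequality_C1:
  fixes A :: "'a::euclidean_space \<Rightarrow> 'a" and G \<phi> :: "'a \<Rightarrow> real"
  assumes A: "A \<in> borel_measurable borel" "locally_bounded A"
    and G: "G \<in> borel_measurable borel" "locally_bounded G"
    and weak: "\<And>\<psi>. test_function UNIV \<psi> \<Longrightarrow> (\<And>x. \<psi> x \<ge> 0) \<Longrightarrow>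
      (\<integral>x. G x * \<psi> x \<partial>lborel) \<le> (\<integral>x. A x \<bullet> grad \<psi> x \<partial>lborel)"
    and \<phi>: "Ck_on 1 UNIV \<phi>" "\<And>x. \<phi> x \<ge> 0" "\<And>x. norm x > R \<Longrightarrow> \<phi> x = 0"
  shows "(\<integral>x. G x * \<phi> x \<partial>lborel) \<le> (\<integral>x. A x \<bullet> grad \<phi> x \<partial>lborel)"
proof -
  note \<phi>' = Ck_on_1D[OF \<phi>(1)]
  define r :: "nat \<Rightarrow> real" where "r j = 1 / Suc j" for j
  have r: "r j > 0" for j by (simp add: r_def)
  define \<phi>s where "\<phi>s j = conv (mollifier (r j)) \<phi>" for j
  have grad_cont: "continuous_on UNIV (\<lambda>z. grad \<phi> z \<bullet> b)" for b
    by (intro continuous_intros \<phi>'(2))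
  have grad_0: "norm x > R \<Longrightarrow> grad \<phi> x \<bullet> b = 0" for x b
    by (simp add: grad_eq_0_outside[OF \<phi>(3)])
  have Ab: "(\<lambda>x. A x \<bullet> b) \<in> borel_measurable borel" for b
    using A(1) by measurable
  have grad_\<phi>s: "grad (\<phi>s j) x \<bullet> b = conv (mollifier (r j)) (\<lambda>z. grad \<phi> z \<bullet> b) x" for j x b
  proof -
    obtain a c where "\<forall>y. y \<notin> cbox a c \<longrightarrow> mollifier (r j) (y::'a) = 0"
      using mollifier_vanishes[of "r j"] r[of j] by auto
    from conv_differentiable(2)[OF continuous_mollifier this \<phi>(1)] show ?thesis
      by (simp add: \<phi>s_def)
  qed
  have \<phi>s_0: "norm x > R + 1 \<Longrightarrow> \<phi>s j x = 0" for x j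
  proof -
    assume "norm x > R + 1"
    then have "norm x > R + r j"
      using order.strict_trans1[of "R + r j" "R + 1" "norm x"] by (simp add: r_def)
    then show ?thesis
      unfolding \<phi>s_def by (intro conv_mollifier_eq_0[OF \<phi>'(3) r \<phi>(3)])
  qed
  have test: "test_function UNIV (\<phi>s j)" for j
  proof -
    obtain a where a: "cball (0::'a) R \<subseteq> cbox (- a) a"
      using bounded_subset_cbox_symmetric[OF bounded_cball] by blast
    have "\<forall>y. y \<notin> cbox (- a) a \<longrightarrow> \<phi> y = 0"
    proof (intro allI impI)
      fix y assume "y \<notin> cbox (- a) a"
      with a have "y \<notin> cball 0 R" by blast
      then show "\<phi> y = 0" by (simp add: \<phi>(3))
    qed
    from Ck_on_conv[OF \<phi>'(3) this Ck_on_mollifier]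
    have "Ck_on k UNIV (\<phi>s j)" for k
      by (simp add: \<phi>s_def conv_commute[OF continuous_mollifier \<phi>'(3)])
    moreover have "closure {x. \<phi>s j x \<noteq> 0} \<subseteq> cball 0 (R + 1)"
      by (rule closure_minimal) (use \<phi>s_0 in \<open>force simp: not_less[symmetric]\<close>, simp)
    then have "compact (closure {x. \<phi>s j x \<noteq> 0})"
      by (meson bounded_cball bounded_subset closed_closure compact_eq_bounded_closed)
    ultimately show ?thesis
      unfolding test_function_def by blast
  qed
  have nonneg: "\<phi>s j x \<ge> 0" for j x
    unfolding \<phi>s_def conv_def
    by (intro Bochner_Integration.integral_nonneg mult_nonneg_nonneg mollifier_nonneg \<phi>(2))
  have "(\<lambda>j. \<integral>x. G x * \<phi>s j x \<partial>lborel) \<longlonglongrightarrow> (\<integral>x. G x * \<phi> x \<partial>lborel)"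
    unfolding \<phi>s_def r_def
    by (rule tendsto_integral_mult_conv_mollifier[OF G \<phi>'(3) \<phi>(3)])
  moreover have "(\<lambda>j. \<integral>x. A x \<bullet> grad (\<phi>s j) x \<partial>lborel) \<longlonglongrightarrow> (\<integral>x. A x \<bullet> grad \<phi> x \<partial>lborel)"
  proof -
    \<comment> \<open>Convolution acts on scalars, so the gradients are handled by components.\<close>
    have split: "(\<integral>x. A x \<bullet> grad f x \<partial>lborel) = (\<Sum>b\<in>Basis. \<integral>x. (A x \<bullet> b) * (grad f x \<bullet> b) \<partial>lborel)"
      if f: "Ck_on 1 UNIV f" "\<And>x. norm x > R' \<Longrightarrow> f x = 0" for f R'
    proof -
      have "integrable lborel (\<lambda>x. (A x \<bullet> b) * (grad f x \<bullet> b))" for b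
        by (rule integrable_locally_bounded_mult[OF Ab locally_bounded_inner[OF A(2)], where R = R'])
          (auto intro!: continuous_intros Ck_on_1D[OF f(1)] simp: grad_eq_0_outside[OF f(2)])
      then show ?thesis
        by (subst euclidean_inner) (simp add: Bochner_Integration.integral_sum)
    qed
    have "(\<integral>x. A x \<bullet> grad (\<phi>s j) x \<partial>lborel)
        = (\<Sum>b\<in>Basis. \<integral>x. (A x \<bullet> b) * conv (mollifier (r j)) (\<lambda>z. grad \<phi> z \<bullet> b) x \<partial>lborel)" for j
      unfolding grad_\<phi>s[symmetric]
      by (rule split[OF _ \<phi>s_0]) (use test[of j] in \<open>unfold test_function_def, blast\<close>)
    moreover have "(\<integral>x. A x \<bullet> grad \<phi> x \<partial>lborel)
        = (\<Sum>b\<in>Basis. \<integral>x. (A x \<bullet> b) * (grad \<phi> x \<bullet> b) \<partial>lborel)"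
      by (rule split[OF \<phi>(1) \<phi>(3)])
    ultimately show ?thesis
      unfolding r_def
      by (simp only:) (intro tendsto_sum tendsto_integral_mult_conv_mollifier[OF Ab locally_bounded_inner[OF A(2)]
            grad_cont grad_0])
  qed
  ultimately show ?thesis
    by (rule LIMSEQ_le) (use weak[OF test nonneg] in blast)
qed

section \<open>Exponents and the pointwise inequality\<close>

text \<open>Testing with \<open>u\<^bsup>-d\<^esup>\<zeta>\<^sup>k\<close> produces the integrands \<open>T\<^sub>1 = u\<^bsup>q-d\<^esup>|\<nabla>u|\<^bsup>p\<^esup>\<close> and
  \<open>T\<^sub>2 = u\<^bsup>-d-1\<^esup>|\<nabla>u|\<^bsup>m\<^esup>\<close>; the last two equations say exactly that
  \<open>T\<^sub>1\<^bsup>a\<^esup> T\<^sub>2\<^bsup>b\<^esup> = u\<^bsup>-d\<^esup>|\<nabla>u|\<^bsup>m-1\<^esup>\<close>. Given \<open>c\<close>, the three equations determine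
  \<open>a\<close>, \<open>b\<close> and \<open>d\<close>. At \<open>c = 1/N\<close> the condition \<open>d > 0\<close> is the subcriticality assumption, so
  that it persists, by continuity, for \<open>c\<close> slightly below \<open>1/N\<close>.\<close>

lemma exponents_exist:
  fixes N m p q :: real
  assumes N: "m < N" and m: "1 < m" and "p \<ge> 0" "q \<ge> 0"
    and sub: "q * (N - m) + p * (N - 1) < N * (m - 1)"
  obtains a b c d where "0 < a" "0 < b" "0 < c" "c < 1 / N" "0 < d" "a + b + c = 1"
    "p * a + m * b = m - 1" "(q - d) * a - (d + 1) * b = - d"
proof -
  have "p * (N - 1) < N * (m - 1)"
    using sub assms by (smt (verit) mult_nonneg_nonneg)
  also have "\<dots> < m * (N - 1)"
    using N by (simp add: algebra_simps)
  finally have mp: "p < m"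
    using N m by simp
  \<comment> \<open>\<open>F c\<close> is \<open>(m - p) (b - q a) = (m - p) c d\<close>, for the \<open>a\<close>, \<open>b\<close>, \<open>d\<close> belonging to \<open>c\<close>.\<close>
  define F where "F c = (1 - c) * (m - p) - (1 + q) * (1 - c * m)" for c
  have "N * F (1 / N) = (N - 1) * (m - p) - (1 + q) * (N - m)"
    using N m by (simp add: F_def field_simps)
  also have "\<dots> > 0"
    using sub by (simp add: algebra_simps)
  finally have "F (1 / N) > 0"
    using N m by (simp add: zero_less_mult_iff)
  moreover have "(F \<longlongrightarrow> F (1 / N)) (at_left (1 / N))"
    unfolding F_def by (intro tendsto_intros)
  ultimately have "\<forall>\<^sub>F c in at_left (1 / N). F c > 0"
    by (simp add: order_tendstoD(1))
  moreover have "\<forall>\<^sub>F c in at_left (1 / N). 0 < c \<and> c < 1 / N"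
    using eventually_at_left_real[of 0 "1 / N"] N m by simp
  ultimately have "\<forall>\<^sub>F c in at_left (1 / N). F c > 0 \<and> 0 < c \<and> c < 1 / N"
    by eventually_elim simp
  then obtain c where c: "F c > 0" "0 < c" "c < 1 / N"
    using eventually_happens[of _ "at_left (1 / N)"] by (auto simp: trivial_limit_at_left_real)
  define a where "a = (1 - c * m) / (m - p)"
  define b where "b = 1 - a - c"
  define d where "d = (b - q * a) / c"
  have "c * m < c * N"
    using c N by simp
  also have "\<dots> < 1"
    using c N m by (simp add: field_simps)
  finally have a: "a > 0"
    using mp by (simp add: a_def)
  have am: "a * (m - p) = 1 - c * m"
    using mp by (simp add: a_def)
  have "(b - q * a) * (m - p) = F c"
    unfolding b_def F_def left_diff_distrib mult.assoc am
    by (simp add: algebra_simps am[unfolded right_diff_distrib])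
  then have bq: "b - q * a > 0"
    using c(1) mp by (metis diff_gt_0_iff_gt zero_less_mult_pos2)
  then have "b > 0"
    using a \<open>q \<ge> 0\<close> by (smt (verit) mult_nonneg_nonneg)
  moreover have "d > 0"
    using bq c by (simp add: d_def)
  moreover have "a + b + c = 1"
    by (simp add: b_def)
  moreover have "p * a + m * b = m - 1"
    using am unfolding b_def by (simp add: algebra_simps)
  moreover have "(q - d) * a - (d + 1) * b = - d"
  proof -
    have "d * c = b - q * a"
      using c by (simp add: d_def)
    moreover have "(q - d) * a - (d + 1) * b = q * a - b - d * (a + b)"
      by (simp add: algebra_simps)
    moreover have "a + b = 1 - c"
      by (simp add: b_def)
    ultimately show ?thesis by (simp add: algebra_simps)
  qed
  ultimately show thesis
    using that a c by blast
qed

text \<open>Young's inequality with three factors, written in logarithms; the constants of the sharp form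
  are dropped, which leaves the bound of a weighted mean by the maximum.\<close>

lemma exp_convex_comb_le_sum:
  fixes x y z :: real
  assumes "0 \<le> a" "0 \<le> b" "0 \<le> c" "a + b + c = 1"
  shows "exp (a * x + b * y + c * z) \<le> exp x + exp y + exp z"
proof -
  define M where "M = max x (max y z)"
  have "a * x + b * y + c * z \<le> a * M + b * M + c * M"
    unfolding M_def using assms by (intro add_mono mult_left_mono) auto
  also have "\<dots> = M"
    using assms(4) by (metis mult_1 distrib_right)
  finally have "exp (a * x + b * y + c * z) \<le> exp M" by simp
  also have "\<dots> \<le> exp x + exp y + exp z"
    unfolding M_def max_def using exp_ge_zero[of x] exp_ge_zero[of y] exp_ge_zero[of z]
    by (simp del: exp_ge_zero)
  finally show ?thesis .
qed

text \<open>The power \<open>z\<^bsup>k-1\<^esup>\<close> of the cutoff is shared out among the first two terms, which take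
  \<open>z\<^bsup>k(a+b)\<^esup> = z\<^bsup>k(1-c)\<^esup>\<close>; the rest is at most \<open>1\<close> because \<open>z \<le> 1 \<le> k c\<close>. In logarithms
  the claim is linear, and the case in which some factor vanishes is separate.\<close>

lemma absorb_gradient_term:
  fixes U Y z s e :: real
  assumes "0 \<le> a" "0 \<le> b" "0 < c" "a + b + c = 1" "p * a + m * b = m - 1"
    "(q - d) * a - (d + 1) * b = - d"
    and "1 < m" "1 \<le> k * c" "k \<ge> 2" and U: "U > 0" and Y: "Y \<ge> 0" and z: "0 \<le> z" "z \<le> 1"
    and s: "s \<ge> 0" and e: "e > 0"
  shows "s * (Y powr (m - 1) * U powr (- d) * z ^ (k - 1))
    \<le> e * (U powr (q - d) * rpow Y p * z ^ k) + e * (Y powr m * U powr (- d - 1) * z ^ k)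
       + (s * e powr (c - 1)) powr (1 / c)"
proof (cases "Y = 0 \<or> z = 0 \<or> s = 0")
  case True
  then have "s * (Y powr (m - 1) * U powr (- d) * z ^ (k - 1)) = 0"
    using \<open>1 < m\<close> \<open>k \<ge> 2\<close> by auto
  also have "\<dots> \<le> e * (U powr (q - d) * rpow Y p * z ^ k) + e * (Y powr m * U powr (- d - 1) * z ^ k)
       + (s * e powr (c - 1)) powr (1 / c)"
    using z e by (auto intro!: add_nonneg_nonneg mult_nonneg_nonneg simp: rpow_def)
  finally show ?thesis .
next
  case False
  then have pos: "Y > 0" "z > 0" "s > 0"
    using Y z s by auto
  define u y \<zeta> \<sigma> \<epsilon> where logs: "u = ln U" "y = ln Y" "\<zeta> = ln z" "\<sigma> = ln s" "\<epsilon> = ln e"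
  have exps: "U = exp u" "Y = exp y" "z = exp \<zeta>" "s = exp \<sigma>" "e = exp \<epsilon>"
    using pos U e by (simp_all add: logs)
  have \<zeta>: "\<zeta> \<le> 0"
    using z pos by (simp add: logs)
  define X1 where "X1 = \<epsilon> + (q - d) * u + p * y + k * \<zeta>"
  define X2 where "X2 = \<epsilon> + m * y + (- d - 1) * u + k * \<zeta>"
  define X3 where "X3 = (\<sigma> + (c - 1) * \<epsilon>) / c"
  have zk: "z ^ j = exp (j * \<zeta>)" for j
    by (simp add: exps exp_of_nat_mult)
  have "s * (Y powr (m - 1) * U powr (- d) * z ^ (k - 1))
      = exp (\<sigma> + (m - 1) * y - d * u + (k - 1) * \<zeta>)"
    unfolding zk using \<open>k \<ge> 2\<close> by (simp add: exps powr_def exp_add[symmetric] of_nat_diff algebra_simps)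
  also have "\<dots> \<le> exp (a * X1 + b * X2 + c * X3)"
  proof -
    have "c * X3 = \<sigma> + (c - 1) * \<epsilon>"
      using \<open>c > 0\<close> by (simp add: X3_def)
    then have "a * X1 + b * X2 + c * X3
        = (a + b) * \<epsilon> + (\<sigma> + (c - 1) * \<epsilon>) + ((q - d) * a - (d + 1) * b) * u
          + (p * a + m * b) * y + (a + b) * (k * \<zeta>)"
      by (simp add: X1_def X2_def algebra_simps)
    also have "\<dots> = \<sigma> - d * u + (m - 1) * y + (1 - c) * (k * \<zeta>)"
    proof -
      have "a + b = 1 - c" using assms(4) by simp
      show ?thesis unfolding assms(5,6) \<open>a + b = 1 - c\<close> by (simp add: algebra_simps)
    qed
    finally have "a * X1 + b * X2 + c * X3 - (\<sigma> + (m - 1) * y - d * u + (k - 1) * \<zeta>)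
        = (1 - k * c) * \<zeta>"
      using \<open>k \<ge> 2\<close> by (simp add: algebra_simps of_nat_diff)
    moreover have "(1 - k * c) * \<zeta> \<ge> 0"
      using \<zeta> assms(8) by (intro mult_nonpos_nonpos) auto
    ultimately show ?thesis by simp
  qed
  also have "\<dots> \<le> exp X1 + exp X2 + exp X3"
    by (rule exp_convex_comb_le_sum) (use assms in auto)
  also have "exp X1 = e * (U powr (q - d) * rpow Y p * z ^ k)"
    unfolding zk X1_def by (simp add: exps powr_def rpow_def exp_add[symmetric] algebra_simps)
  also have "exp X2 = e * (Y powr m * U powr (- d - 1) * z ^ k)"
    unfolding zk X2_def by (simp add: exps powr_def exp_add[symmetric] algebra_simps)
  also have "exp X3 = (s * e powr (c - 1)) powr (1 / c)"
  proof -
    have "s * e powr (c - 1) = exp (\<sigma> + (c - 1) * \<epsilon>)"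
      by (simp add: exps powr_def exp_add)
    then show ?thesis
      by (simp add: X3_def powr_def)
  qed
  finally show ?thesis .
qed

section \<open>The test function\<close>

text \<open>A truncated paraboloid instead of a smooth plateau: its powers of order \<open>k \<ge> 2\<close> are of class
  \<open>C\<^sup>1\<close>, and it increases with \<open>R\<close>, so energies at different scales can be compared directly.\<close>

definition cutoff :: "real \<Rightarrow> 'a::euclidean_space \<Rightarrow> real" where
  "cutoff R x = max 0 (1 - x \<bullet> x / R\<^sup>2)"

lemma cutoff_bounds: "0 \<le> cutoff R x" "cutoff R x \<le> 1"
  by (simp_all add: cutoff_def)

lemma cutoff_eq_0:
  assumes "R > 0" and "norm x > R"
  shows "cutoff R x = 0"
proof -
  have "R\<^sup>2 \<le> x \<bullet> x"
    using assms by (metis less_imp_le power_mono power2_norm_eq_inner)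
  then show ?thesis using assms by (simp add: cutoff_def field_simps)
qed

lemma cutoff_mono:
  assumes "0 < R" and "R \<le> S"
  shows "cutoff R x \<le> cutoff S x"
proof -
  have "x \<bullet> x / S\<^sup>2 \<le> x \<bullet> x / R\<^sup>2"
    using assms by (intro divide_left_mono power_mono) auto
  then show ?thesis by (auto simp: cutoff_def)
qed

lemma continuous_cutoff: "continuous_on UNIV (cutoff R)"
  unfolding cutoff_def[abs_def] divide_inverse by (intro continuous_intros)

lemma DERIV_pos_part_power:
  fixes t :: real
  assumes "k \<ge> 2"
  shows "((\<lambda>t. (max 0 t) ^ k) has_real_derivative k * (max 0 t) ^ (k - 1)) (at t)"
proof -
  consider "t > 0" | "t < 0" | "t = 0" by linarith
  then show ?thesis
  proof cases
    case 1
    have "((\<lambda>t. t ^ k) has_real_derivative k * (max 0 t) ^ (k - 1)) (at t)"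
      using 1 DERIV_pow[of k t] by simp
    then show ?thesis
      by (rule has_field_derivative_transform_within_open[of _ _ _ "{0<..}"]) (use 1 in auto)
  next
    case 2
    have "((\<lambda>t. 0) has_real_derivative k * (max 0 t) ^ (k - 1)) (at t)"
      using 2 assms by (simp add: max_def zero_power)
    then show ?thesis
      by (rule has_field_derivative_transform_within_open[of _ _ _ "{..<0}"]) (use 2 assms in auto)
  next
    case 3
    obtain j where k: "k = Suc (Suc j)"
      using assms by (metis add_2_eq_Suc le_iff_add)
    have "((\<lambda>s::real. (max 0 s) ^ Suc j) \<longlongrightarrow> (max 0 0) ^ Suc j) (at 0)"
      by (intro tendsto_intros)
    then have "((\<lambda>s::real. (max 0 s) ^ Suc j) \<longlongrightarrow> 0) (at 0)"
      by simp
    then have "((\<lambda>s::real. (max 0 s) ^ k / s) \<longlongrightarrow> 0) (at 0)"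
      by (rule Lim_transform_eventually) (auto simp: eventually_at_filter k max_def)
    then show ?thesis
      using 3 k by (simp add: has_field_derivative_iff)
  qed
qed

lemma GDERIV_cutoff_power:
  fixes x :: "'a::euclidean_space"
  assumes "k \<ge> 2"
  shows "GDERIV (\<lambda>x. cutoff R x ^ k) x :> (k * cutoff R x ^ (k - 1)) *\<^sub>R ((- 2 / R\<^sup>2) *\<^sub>R x)"
proof -
  have "GDERIV (\<lambda>x. 1 - x \<bullet> x / R\<^sup>2) x :> (- 2 / R\<^sup>2) *\<^sub>R x"
    unfolding gderiv_def
    by (auto intro!: derivative_eq_intros simp: inner_commute divide_inverse)
  from GDERIV_DERIV_compose[OF this DERIV_pos_part_power[OF assms]] show ?thesis
    unfolding cutoff_def .
qed

section \<open>The energy estimate\<close>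

lemma continuous_imp_locally_bounded:
  fixes f :: "'a::euclidean_space \<Rightarrow> 'b::euclidean_space"
  assumes "continuous_on UNIV f"
  shows "locally_bounded f"
  unfolding locally_bounded_def
proof
  fix R
  have "compact (f ` cball 0 R)"
    by (rule compact_continuous_image[OF continuous_on_subset[OF assms]]) auto
  then show "\<exists>M. \<forall>x\<in>cball 0 R. norm (f x) \<le> M"
    by (auto dest!: compact_imp_bounded simp: bounded_iff)
qed

lemma integrable_locally_bounded_inner:
  fixes A g :: "'a::euclidean_space \<Rightarrow> 'a"
  assumes A: "A \<in> borel_measurable borel" "locally_bounded A"
    and g: "continuous_on UNIV g" "\<And>x. norm x > R \<Longrightarrow> g x = 0"
  shows "integrable lborel (\<lambda>x. A x \<bullet> g x)"
proof -
  have "integrable lborel (\<lambda>x. (A x \<bullet> b) * (g x \<bullet> b))" for b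
    by (rule integrable_locally_bounded_mult[OF _ locally_bounded_inner[OF A(2)], where R = R])
      (use A(1) in measurable, auto intro!: continuous_intros g(1) simp: g(2))
  then show ?thesis
    by (subst euclidean_inner) (simp add: Bochner_Integration.integrable_sum)
qed

lemma borel_measurable_rpow [measurable (raw)]:
  "f \<in> borel_measurable M \<Longrightarrow> (\<lambda>x. rpow (f x) a) \<in> borel_measurable M"
  unfolding rpow_def by (cases "a = 0") simp_all

lemma continuous_on_rpow_nonneg:
  assumes "continuous_on S f" "a \<ge> 0" "\<And>x. x \<in> S \<Longrightarrow> f x \<ge> 0"
  shows "continuous_on S (\<lambda>x. rpow (f x) a)"
  using assms unfolding rpow_def
  by (cases "a = 0") (auto intro!: continuous_on_powr' continuous_on_const)

text \<open>At \<open>v = 0\<close> the scalar factor may be \<open>0\<close>, or \<open>1\<close> when \<open>m = 2\<close>; the vector is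
  zero in every case.\<close>

lemma norm_flux:
  "norm (rpow (norm v) (m - 2) *\<^sub>R v) = norm v powr (m - 1)"
proof (cases "v = 0")
  case False
  then have "norm v powr (m - 1) = norm v powr (m - 2) * norm v"
    using powr_add[of "norm v" "m - 2" 1] by simp
  then show ?thesis
    using False by (auto simp: rpow_def)
qed simp

lemma flux_inner_self:
  "(rpow (norm v) (m - 2) *\<^sub>R v) \<bullet> v = norm v powr m"
proof (cases "v = 0")
  case False
  have "norm v powr m = norm v powr (m - 2) * (v \<bullet> v)"
    using powr_add[of "norm v" "m - 2" 2] False by (simp add: power2_norm_eq_inner)
  then show ?thesis
    using False by (auto simp: rpow_def dot_square_norm)
qed simp

text \<open>Testing with \<open>\<phi> = u\<^bsup>-d\<^esup>\<zeta>\<^sup>k\<close>, where \<open>\<zeta>\<close> is the cutoff, the derivative of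
  \<open>u\<^bsup>-d\<^esup>\<close> moves \<open>d \<integral> T\<^sub>2 \<zeta>\<^sup>k\<close> to the side of the source term \<open>\<integral> T\<^sub>1 \<zeta>\<^sup>k\<close>. The
  remaining term carries \<open>|\<nabla>\<zeta>| \<le> 2/R\<close>; it is absorbed into these two integrals up to a constant
  of order \<open>R\<^bsup>-1/c\<^esup>\<close>, integrated over a ball of volume of order \<open>R\<^sup>N\<close>.\<close>

lemma energy_estimate:
  fixes u :: "'a::euclidean_space \<Rightarrow> real"
  assumes u: "Ck_on 1 UNIV u" "\<And>x. u x > 0"
    and weak: "\<And>\<psi>. test_function UNIV \<psi> \<Longrightarrow> (\<And>x. \<psi> x \<ge> 0) \<Longrightarrow>
      (\<integral>x. (rpow (u x) q * rpow (norm (grad u x)) p) * \<psi> x \<partial>lborel)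
        \<le> (\<integral>x. (rpow (norm (grad u x)) (m - 2) *\<^sub>R grad u x) \<bullet> grad \<psi> x \<partial>lborel)"
    and exps: "0 < a" "0 < b" "0 < c" "0 < d" "a + b + c = 1" "p * a + m * b = m - 1"
      "(q - d) * a - (d + 1) * b = - d"
    and "1 < m" "p \<ge> 0" "q \<ge> 0" and k: "1 \<le> k * c" "k \<ge> 2"
  obtains K where "\<And>R. R > 0 \<Longrightarrow>
    (\<integral>x. norm (grad u x) powr m * u x powr (- d - 1) * cutoff R x ^ k \<partial>lborel)
      \<le> K * R powr (DIM('a) - 1 / c)"
proof
  note u' = Ck_on_1D[OF u(1)]
  have [measurable]: "u \<in> borel_measurable borel" "grad u \<in> borel_measurable borel"
    using u'(2,3) by (auto intro: borel_measurable_continuous_onI)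
  define A where "A x = rpow (norm (grad u x)) (m - 2) *\<^sub>R grad u x" for x
  define G where "G x = rpow (u x) q * rpow (norm (grad u x)) p" for x
  define T where "T x = norm (grad u x) powr m * u x powr (- d - 1)" for x
  \<comment> \<open>With \<open>e \<le> 1\<close> the source term absorbs its share, with \<open>e \<le> d / 2\<close> the gradient
     term keeps half of its coefficient.\<close>
  define e where "e = min 1 (d / 2)"
  have e: "e > 0" "e \<le> 1" "e \<le> d / 2"
    using \<open>0 < d\<close> by (auto simp: e_def)
  have A_meas: "A \<in> borel_measurable borel"
    unfolding A_def[abs_def] by measurable
  have "continuous_on UNIV (\<lambda>x. norm (grad u x) powr (m - 1))"
    using \<open>1 < m\<close> by (intro continuous_on_powr' continuous_intros u'(2)) auto
  then have A_bdd: "locally_bounded A"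
    using continuous_imp_locally_bounded[of "\<lambda>x. norm (grad u x) powr (m - 1)"]
    unfolding locally_bounded_def A_def by (simp add: norm_flux del: norm_scaleR)
  have "continuous_on UNIV G"
    unfolding G_def[abs_def] using u(2) \<open>p \<ge> 0\<close> \<open>q \<ge> 0\<close>
    by (intro continuous_intros continuous_on_rpow_nonneg u') (auto intro: less_imp_le)
  then have G: "G \<in> borel_measurable borel" "locally_bounded G"
    by (auto intro: borel_measurable_continuous_onI continuous_imp_locally_bounded)
  have upow: "continuous_on UNIV (\<lambda>x. u x powr s)" for s
    by (intro continuous_intros u'(3)) (metis less_irrefl u(2))
  have T_cont: "continuous_on UNIV T"
    unfolding T_def[abs_def] using \<open>1 < m\<close>
    by (intro continuous_on_mult upow continuous_on_powr' continuous_intros u'(2)) auto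
  define K0 where "K0 = (2 * k * e powr (c - 1)) powr (1 / c)"
  define K where "K = 2 / d * (K0 * unit_ball_vol (DIM('a)))"
  fix R :: real assume R: "R > 0"
  define W where "W = (2 * k / R * e powr (c - 1)) powr (1 / c)"
  define \<phi> where "\<phi> x = u x powr (- d) * cutoff R x ^ k" for x
  define D where "D x = u x powr (- d) *\<^sub>R ((k * cutoff R x ^ (k - 1)) *\<^sub>R ((- 2 / R\<^sup>2) *\<^sub>R x))
      + cutoff R x ^ k *\<^sub>R ((- d * u x powr (- d - 1)) *\<^sub>R grad u x)" for x
  have D: "GDERIV \<phi> x :> D x" for x
    unfolding \<phi>_def[abs_def] D_def
    by (intro GDERIV_mult GDERIV_cutoff_power[OF k(2)] GDERIV_DERIV_compose[OF u'(1)]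
        has_real_derivative_powr u(2))
  have grad_\<phi>: "grad \<phi> x = D x" for x
    by (rule grad_eqI[OF D])
  have D_cont: "continuous_on UNIV D"
    unfolding D_def[abs_def] by (intro continuous_intros upow continuous_cutoff u'(2))
  have \<phi>: "Ck_on 1 UNIV \<phi>"
    by (rule Ck_on_1I[OF D D_cont])
  have \<phi>_0: "\<phi> x = 0" if "norm x > R" for x
    using cutoff_eq_0[OF R that] k(2) by (simp add: \<phi>_def)
  have D_0: "D x = 0" if "norm x > R" for x
    using cutoff_eq_0[OF R that] k(2) by (simp add: D_def zero_power)
  have ineq: "(\<integral>x. G x * \<phi> x \<partial>lborel) \<le> (\<integral>x. A x \<bullet> D x \<partial>lborel)"
    unfolding grad_\<phi>[symmetric]
  proof (rule weak_inequality_C1[OF A_meas A_bdd G _ \<phi> _ \<phi>_0])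
    show "\<phi> x \<ge> 0" for x
      by (simp add: \<phi>_def cutoff_bounds)
  qed (use weak in \<open>auto simp: A_def G_def\<close>)
  have pointwise: "A x \<bullet> D x - G x * \<phi> x \<le> W * indicator (cball 0 R) x - d / 2 * (T x * cutoff R x ^ k)" for x
  proof (cases "norm x > R")
    case True
    then show ?thesis
      using cutoff_eq_0[OF R True] k(2) by (simp add: D_0 \<phi>_0 zero_power)
  next
    case False
    define z where "z = cutoff R x"
    have z: "0 \<le> z" "z \<le> 1"
      unfolding z_def by (rule cutoff_bounds)+
    have "- (A x \<bullet> x) \<le> norm (A x) * norm x"
      using norm_cauchy_schwarz[of "- A x" x] by simp
    also have "\<dots> \<le> norm (grad u x) powr (m - 1) * R"
      unfolding A_def norm_flux using False by (intro mult_left_mono) auto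
    finally have Ax: "- (A x \<bullet> x) \<le> norm (grad u x) powr (m - 1) * R" .
    have "A x \<bullet> D x = (2 * k / R\<^sup>2 * u x powr (- d) * z ^ (k - 1)) * - (A x \<bullet> x)
        - d * u x powr (- d - 1) * z ^ k * (A x \<bullet> grad u x)"
      by (simp add: D_def z_def inner_add_right algebra_simps)
    also have "A x \<bullet> grad u x = norm (grad u x) powr m"
      unfolding A_def by (rule flux_inner_self)
    also have "(2 * k / R\<^sup>2 * u x powr (- d) * z ^ (k - 1)) * - (A x \<bullet> x)
        \<le> (2 * k / R\<^sup>2 * u x powr (- d) * z ^ (k - 1)) * (norm (grad u x) powr (m - 1) * R)"
      using z by (intro mult_left_mono Ax) auto
    also have "\<dots> = 2 * k / R * (norm (grad u x) powr (m - 1) * u x powr (- d) * z ^ (k - 1))"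
      using R by (simp add: power2_eq_square)
    also have "\<dots> \<le> e * (u x powr (q - d) * rpow (norm (grad u x)) p * z ^ k) + e * (T x * z ^ k) + W"
      unfolding W_def T_def
      by (rule absorb_gradient_term[of a b c p m q d]) (use exps k z e R u(2)[of x] \<open>1 < m\<close> in auto)
    also have "u x powr (q - d) = rpow (u x) q * u x powr (- d)"
      using u(2)[of x] powr_add[of "u x" q "- d"] by (simp add: rpow_def)
    also have "rpow (u x) q * u x powr (- d) * rpow (norm (grad u x)) p * z ^ k = G x * \<phi> x"
      by (simp add: G_def \<phi>_def z_def)
    also have "e * (G x * \<phi> x) \<le> 1 * (G x * \<phi> x)"
      using e by (intro mult_right_mono) (auto simp: G_def \<phi>_def rpow_def cutoff_bounds)
    also have "e * (T x * z ^ k) \<le> d / 2 * (T x * z ^ k)"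
      using e z by (intro mult_right_mono) (auto simp: T_def)
    finally show ?thesis
      using False by (simp add: z_def T_def field_simps)
  qed
  have int_AD: "integrable lborel (\<lambda>x. A x \<bullet> D x)"
    by (rule integrable_locally_bounded_inner[OF A_meas A_bdd D_cont D_0])
  have int_G: "integrable lborel (\<lambda>x. G x * \<phi> x)"
    by (rule integrable_locally_bounded_mult[OF G Ck_on_1D(3)[OF \<phi>] \<phi>_0])
  have int_T: "integrable lborel (\<lambda>x. T x * cutoff R x ^ k)"
    by (rule integrable_continuous_compact_support[of _ "cball 0 R"])
      (use cutoff_eq_0[OF R] k(2) in \<open>auto simp: not_le intro!: continuous_intros T_cont continuous_cutoff\<close>)
  have int_W: "integrable lborel (\<lambda>x::'a. W * indicator (cball 0 R) x)"
    by (intro integrable_mult_right integrable_real_indicator emeasure_bounded_finite) simp_all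
  have "0 \<le> (\<integral>x. A x \<bullet> D x - G x * \<phi> x \<partial>lborel)"
    using ineq by (simp add: Bochner_Integration.integral_diff[OF int_AD int_G])
  also have "\<dots> \<le> (\<integral>x. W * indicator (cball 0 R) x - d / 2 * (T x * cutoff R x ^ k) \<partial>lborel)"
    by (intro integral_mono Bochner_Integration.integrable_diff int_AD int_G int_W
        integrable_mult_right int_T pointwise)
  also have "\<dots> = W * measure lborel (cball (0::'a) R) - d / 2 * (\<integral>x. T x * cutoff R x ^ k \<partial>lborel)"
    by (subst Bochner_Integration.integral_diff[OF int_W integrable_mult_right[OF int_T]]) simp
  also have "W * measure lborel (cball (0::'a) R) = K0 * unit_ball_vol (DIM('a)) * R powr (DIM('a) - 1 / c)"
  proof -
    have "W = ((2 * k * e powr (c - 1)) * (1 / R)) powr (1 / c)"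
      by (simp add: W_def)
    also have "\<dots> = K0 * (1 / R) powr (1 / c)"
      unfolding K0_def by (rule powr_mult)
    also have "(1 / R) powr (1 / c) = R powr (- (1 / c))"
      using R by (simp add: powr_divide powr_minus_divide)
    finally have "W = K0 * R powr (- (1 / c))" .
    moreover have "R powr (DIM('a) - 1 / c) = R ^ DIM('a) * R powr (- (1 / c))"
      using R powr_add[of R "DIM('a)" "- (1 / c)"] by (simp add: powr_realpow)
    ultimately show ?thesis
      using R by (simp add: content_cball)
  qed
  finally have "d / 2 * (\<integral>x. T x * cutoff R x ^ k \<partial>lborel)
      \<le> K0 * unit_ball_vol (DIM('a)) * R powr (DIM('a) - 1 / c)"
    by simp
  then have "(\<integral>x. T x * cutoff R x ^ k \<partial>lborel)
      \<le> 2 / d * (K0 * unit_ball_vol (DIM('a)) * R powr (DIM('a) - 1 / c))"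
    using \<open>0 < d\<close> by (simp add: field_simps)
  then show "(\<integral>x. norm (grad u x) powr m * u x powr (- d - 1) * cutoff R x ^ k \<partial>lborel)
      \<le> K * R powr (DIM('a) - 1 / c)"
    by (simp add: T_def K_def mult.assoc)
qed

section \<open>Vanishing of the gradient\<close>

text \<open>The exponents can be chosen with \<open>1/c > N\<close>, so the energy estimate forces
  \<open>\<integral> T\<^sub>2 \<zeta>\<^sup>k \<rightarrow> 0\<close> as \<open>R \<rightarrow> \<infinity>\<close>. These integrals increase with
  \<open>R\<close>, so they all vanish, and \<open>T\<^sub>2\<close> is continuous and nonnegative.\<close>

theorem grad_eq_0_of_subcritical:
  fixes m p q :: real and u :: "'a::euclidean_space \<Rightarrow> real"
  assumes m: "1 < m" "m < DIM('a)" and "p \<ge> 0" "q \<ge> 0"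
    and sub: "q * (DIM('a) - m) + p * (real DIM('a) - 1) < DIM('a) * (m - 1)"
    and sol: "positive_weak_solution m (\<lambda>x s \<xi>. rpow s q * rpow (norm \<xi>) p) UNIV u"
  shows "grad u x0 = 0"
proof (rule ccontr)
  assume "grad u x0 \<noteq> 0"
  have u: "Ck_on 1 UNIV u" "\<And>x. u x > 0"
    using sol unfolding positive_weak_solution_def by auto
  note u' = Ck_on_1D[OF u(1)]
  have [measurable]: "u \<in> borel_measurable borel" "grad u \<in> borel_measurable borel"
    using u'(2,3) by (auto intro: borel_measurable_continuous_onI)
  have weak: "(\<integral>x. (rpow (u x) q * rpow (norm (grad u x)) p) * \<psi> x \<partial>lborel)
        \<le> (\<integral>x. (rpow (norm (grad u x)) (m - 2) *\<^sub>R grad u x) \<bullet> grad \<psi> x \<partial>lborel)"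
    if "test_function UNIV \<psi>" "\<And>x. \<psi> x \<ge> 0" for \<psi>
  proof -
    have "Ck_on 1 UNIV \<psi>"
      using that(1) unfolding test_function_def by blast
    note \<psi> = Ck_on_1D(2,3)[OF this]
    have [measurable]: "\<psi> \<in> borel_measurable borel" "grad \<psi> \<in> borel_measurable borel"
      using \<psi> by (auto intro: borel_measurable_continuous_onI)
    have leb: "(LINT x:UNIV|lebesgue. f x) = (\<integral>x. f x \<partial>lborel)"
      if "f \<in> borel_measurable borel" for f :: "'a \<Rightarrow> real"
      using that by (simp add: set_lebesgue_integral_def integral_completion)
    have "(LINT x:UNIV|lebesgue. (rpow (u x) q * rpow (norm (grad u x)) p) * \<psi> x)
        \<le> (LINT x:UNIV|lebesgue. (rpow (norm (grad u x)) (m - 2) *\<^sub>R grad u x) \<bullet> grad \<psi> x)"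
      using sol that unfolding positive_weak_solution_def by blast
    then show ?thesis
      by (subst (asm) (1 2) leb; measurable)
  qed
  obtain a b c d where exps: "0 < a" "0 < b" "0 < c" "c < 1 / DIM('a)" "0 < d" "a + b + c = 1"
    "p * a + m * b = m - 1" "(q - d) * a - (d + 1) * b = - d"
    using exponents_exist[OF m(2,1) \<open>p \<ge> 0\<close> \<open>q \<ge> 0\<close> sub] .
  \<comment> \<open>The exponent has to satisfy \<open>k c \<ge> 1\<close> for the absorption and \<open>k \<ge> 2\<close> for differentiability.\<close>
  define k where "k = max 2 (nat \<lceil>1 / c\<rceil>)"
  have "1 / c \<le> k"
    unfolding k_def by linarith
  then have k: "1 \<le> k * c" "k \<ge> 2"
    using exps(3) by (simp_all add: k_def field_simps)
  obtain K where K: "\<And>R. R > 0 \<Longrightarrow>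
    (\<integral>x. norm (grad u x) powr m * u x powr (- d - 1) * cutoff R x ^ k \<partial>lborel)
      \<le> K * R powr (DIM('a) - 1 / c)"
    using energy_estimate[OF u weak exps(1-3,5-8) m(1) \<open>p \<ge> 0\<close> \<open>q \<ge> 0\<close> k] by blast
  define f where "f R x = norm (grad u x) powr m * u x powr (- d - 1) * cutoff R x ^ k" for R x
  define R0 where "R0 = norm x0 + 1"
  have R0: "R0 > 0"
    unfolding R0_def by (simp add: add_nonneg_pos)
  have f_cont: "continuous_on UNIV (f R)" for R
  proof -
    have "continuous_on UNIV (\<lambda>x. u x powr (- d - 1))"
      by (intro continuous_intros u'(3)) (metis less_irrefl u(2))
    moreover have "continuous_on UNIV (\<lambda>x. norm (grad u x) powr m)"
      using m(1) by (intro continuous_on_powr' continuous_intros u'(2)) auto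
    ultimately show ?thesis
      unfolding f_def[abs_def] by (intro continuous_on_mult continuous_on_power continuous_cutoff)
  qed
  have f_nonneg: "f R x \<ge> 0" for R x
    by (simp add: f_def cutoff_bounds)
  have f_int: "integrable lborel (f R)" if "R > 0" for R
    by (rule integrable_continuous_compact_support[OF f_cont, of "cball 0 R"])
      (use cutoff_eq_0[OF that] k(2) in \<open>auto simp: f_def not_le\<close>)
  have "x0 \<bullet> x0 < R0\<^sup>2"
    unfolding power2_norm_eq_inner[symmetric] R0_def by (rule power_strict_mono) auto
  then have "cutoff R0 x0 > 0"
    using R0 by (simp add: cutoff_def)
  then have "f R0 x0 > 0"
    using \<open>grad u x0 \<noteq> 0\<close> u(2)[of x0] by (simp add: f_def)
  then have pos: "(\<integral>x. f R0 x \<partial>lborel) > 0"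
    by (rule integral_pos_of_continuous[OF f_cont f_nonneg f_int[OF R0]])
  have "(\<integral>x. f R0 x \<partial>lborel) \<le> K * R powr (DIM('a) - 1 / c)" if "R \<ge> R0" for R
  proof -
    have "(\<integral>x. f R0 x \<partial>lborel) \<le> (\<integral>x. f R x \<partial>lborel)"
    proof (rule integral_mono)
      show "f R0 x \<le> f R x" for x
        unfolding f_def by (intro mult_left_mono power_mono cutoff_mono cutoff_bounds R0 that) auto
    qed (use R0 that in \<open>auto intro: f_int\<close>)
    also have "\<dots> \<le> K * R powr (DIM('a) - 1 / c)"
      unfolding f_def using R0 that by (intro K) auto
    finally show ?thesis .
  qed
  then have "\<forall>\<^sub>F R in at_top. (\<integral>x. f R0 x \<partial>lborel) \<le> K * R powr (DIM('a) - 1 / c)"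
    using eventually_at_top_linorder by blast
  moreover have "((\<lambda>R. K * R powr (DIM('a) - 1 / c)) \<longlongrightarrow> 0) at_top"
  proof -
    have "DIM('a) * c < 1"
      using exps(4) by (simp add: field_simps)
    then have "DIM('a) - 1 / c < 0"
      using exps(3) by (simp add: field_simps)
    from tendsto_mult_right_zero[OF tendsto_neg_powr[OF this filterlim_ident]] show ?thesis .
  qed
  ultimately have "(\<integral>x. f R0 x \<partial>lborel) \<le> 0"
    using tendsto_lowerbound[of "\<lambda>R. K * R powr (DIM('a) - 1 / c)" 0 at_top] by simp
  with pos show False by simp
qed

theorem theorem1p2:
  fixes N :: nat and m p q :: real and u :: "real ^ 'n \<Rightarrow> real"
  assumes "CARD('n) = N" and "N \<ge> 2"
    and "1 < m" and "m < real N" and "p \<ge> 0" and "q \<ge> 0"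
    and "q * (real N - m) + p * (real N - 1) < real N * (m - 1)"
    and "positive_weak_solution m (\<lambda>x s \<xi>. rpow s q * rpow (norm \<xi>) p) UNIV u"
  shows "u constant_on UNIV"
proof -
  have dim: "DIM(real ^ 'n) = N"
    using assms(1) by simp
  have grad_0: "grad u x = 0" for x
    by (rule grad_eq_0_of_subcritical[where m = m and p = p and q = q]) (use assms in \<open>simp_all only: dim\<close>)
  have "Ck_on 1 UNIV u"
    using assms(8) unfolding positive_weak_solution_def by blast
  from Ck_on_1D(1)[OF this] have "(u has_derivative (\<lambda>h. 0)) (at x)" for x
    unfolding gderiv_def grad_0 inner_zero_right .
  then have "u x = u y" for x y
    using has_derivative_zero_unique[of UNIV u x y] by simp
  then show ?thesis
    unfolding constant_on_def by blast
qed

end
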